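(* Let $S$ be a block-group. For each $s\in S$ let $\phi_s:\mathscr{D}(s)\to\mathscr{I}(s)$ be the map $x\mapsto xs$, which is a bijection between subsets of $S$ and hence an element of $\mathcal{I}(S)$. Then the mapping $\phi:S\to\mathcal{I}(S)$, $s\mapsto\phi_s$, is a homomorphism of semigroups such that: (1) $\phi$ is injective on $\mathrm{Reg}(S)$, i.e. the kernel of $\phi$ separates regular elements; (2) if $s\in\mathrm{Reg}(S)$ then $\mathscr{D}(s)=Sss^{-1}$ and $\mathscr{I}(s)=Ss^{-1}s$; in particular, if $S$ is an inverse semigroup then $\phi$ is the usual Vagner-Preston representation of $S$. Furthermore, the kernel of $\phi$ is the largest congruence on $S$ that separates regular elements.
   Context: All semigroups are finite. For a semigroup $S$, $S^1$ denotes $S$ if $S$ has an identity, and otherwise $S$ with an identity adjoined. An inverse of $s\in S$ is an element $s'\in S$ with $ss's=s$ and $s'ss'=s'$; $s$ is regular if $s=sxs$ for some $x\in S$ (equivalently, if it has an inverse). $\mathrm{Reg}(S)$ is the set of regular elements and $E(S)$ the set of idempotents of $S$. A block-group is a finite semigroup in which every element has at most one inverse (equivalently, a finite semigroup in which every $\mathscr{R}$-class and every $\mathscr{L}$-class contains at most one idempotent, where $\mathscr{R},\mathscr{L}$ are Green's relations). In a block-group, $s^{-1}$ denotes the unique inverse of a regular element $s$. Quasi-orders: $s\le_{\mathscr{R}}t$ iff $sS^1\subseteq tS^1$, and $s\le_{\mathscr{L}}t$ iff $S^1s\subseteq S^1t$. For $s\in S$ put $\mathscr{R}(s)=\{e\in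 E(S)\mid e\le_{\mathscr{R}}s\}$, $\mathscr{L}(s)=\{e\in E(S)\mid e\le_{\mathscr{L}}s\}$, and $\mathscr{D}(s)=\bigcup\{Se\mid e\in\mathscr{R}(s)\}$, $\mathscr{I}(s)=\bigcup\{Se\mid e\in\mathscr{L}(s)\}$. $\mathcal{I}(S)$ is the symmetric inverse semigroup on the set $S$, i.e. the semigroup of all bijections between subsets of $S$ under composition of partial maps. Maps are written on the right and composed from left to right: $x\phi_s\phi_t=(x\phi_s)\phi_t$, with $\mathrm{Dom}(\phi_s\phi_t)=\{x\in\mathrm{Dom}(\phi_s)\mid x\phi_s\in\mathrm{Dom}(\phi_t)\}$. The kernel of $\phi$ is the congruence $\{(s,t)\in S\times S\mid\phi_s=\phi_t\}$. A congruence $\rho$ on $S$ separates regular elements if $s,t\in\mathrm{Reg}(S)$ and $s\mathrel{\rho}t$ imply $s=t$. "Largest" is with respect to inclusion. For an inverse semigroup $S$, the usual Vagner-Preston representation is the map $S\to\mathcal{I}(S)$ sending $s$ to the partial bijection $Sss^{-1}\to Ss^{-1}s$, $x\mapsto xs$. *)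

theory Defs
  imports Main
begin

(* A finite semigroup S is a type 'a of sort {semigroup_mult, finite}; S itself is UNIV :: 'a set. *)

section \<open>Inverses, regular elements, block-groups\<close>

definition is_inverse :: "'a::semigroup_mult \<Rightarrow> 'a \<Rightarrow> bool" where
  "is_inverse s s' \<longleftrightarrow> s * s' * s = s \<and> s' * s * s' = s'"

definition Reg :: "'a::semigroup_mult set" where
  "Reg = {s. \<exists>x. s = s * x * s}"

definition Idem :: "'a::semigroup_mult set" where
  "Idem = {e. e * e = e}"

definition block_group :: "'a::{semigroup_mult, finite} itself \<Rightarrow> bool" where
  "block_group _ \<longleftrightarrow> (\<forall>s t u :: 'a. is_inverse s t \<longrightarrow> is_inverse s u \<longrightarrow> t = u)"

definition inverse_semigroup :: "'a::{semigroup_mult, finite} itself \<Rightarrow> bool" where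
  "inverse_semigroup _ \<longleftrightarrow> (\<forall>s :: 'a. \<exists>!t. is_inverse s t)"

(* Meaningful only where the inverse exists and is unique, e.g. for s \<in> Reg in a block-group. *)
definition sinv :: "'a::semigroup_mult \<Rightarrow> 'a" where
  "sinv s = (THE t. is_inverse s t)"


section \<open>The monoid \<open>S\<^sup>1\<close> and the Green quasi-orders\<close>

(* Some x stands for x \<in> S; None stands for the identity that is adjoined only if S has none. *)
definition S1 :: "'a::semigroup_mult option set" where
  "S1 = (if \<exists>e::'a. \<forall>x. e * x = x \<and> x * e = x then range Some else UNIV)"

fun mult_S1 :: "'a::semigroup_mult option \<Rightarrow> 'a option \<Rightarrow> 'a option" where
  "mult_S1 None v = v"
| "mult_S1 u None = u"
| "mult_S1 (Some x) (Some y) = Some (x * y)"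

definition le_R :: "'a::semigroup_mult \<Rightarrow> 'a \<Rightarrow> bool" where
  "le_R s t \<longleftrightarrow> (\<lambda>u. mult_S1 (Some s) u) ` S1 \<subseteq> (\<lambda>u. mult_S1 (Some t) u) ` S1"

definition le_L :: "'a::semigroup_mult \<Rightarrow> 'a \<Rightarrow> bool" where
  "le_L s t \<longleftrightarrow> (\<lambda>u. mult_S1 u (Some s)) ` S1 \<subseteq> (\<lambda>u. mult_S1 u (Some t)) ` S1"

definition R_idem :: "'a::semigroup_mult \<Rightarrow> 'a set" where
  "R_idem s = {e \<in> Idem. le_R e s}"

definition L_idem :: "'a::semigroup_mult \<Rightarrow> 'a set" where
  "L_idem s = {e \<in> Idem. le_L e s}"


section \<open>The partial maps \<open>\<phi>\<^sub>s\<close>\<close>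

definition left_mults :: "'a::semigroup_mult \<Rightarrow> 'a set" where
  "left_mults a = {x * a | x. True}"

definition D_set :: "'a::semigroup_mult \<Rightarrow> 'a set" where
  "D_set s = (\<Union>e \<in> R_idem s. left_mults e)"

definition I_set :: "'a::semigroup_mult \<Rightarrow> 'a set" where
  "I_set s = (\<Union>e \<in> L_idem s. left_mults e)"

(* A bijection between subsets of X is encoded as an injective partial map; its codomain is its range. *)
definition sym_inv :: "'x set \<Rightarrow> ('x \<rightharpoonup> 'x) set" where
  "sym_inv X = {f. dom f \<subseteq> X \<and> ran f \<subseteq> X \<and> inj_on f (dom f)}"

(* Left-to-right composition: x(fg) = (xf)g. *)
definition pcomp :: "('x \<rightharpoonup> 'x) \<Rightarrow> ('x \<rightharpoonup> 'x) \<Rightarrow> ('x \<rightharpoonup> 'x)" (infixl \<open>\<Zsemi>\<close> 70) where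
  "f \<Zsemi> g = g \<circ>\<^sub>m f"

definition phi :: "'a::semigroup_mult \<Rightarrow> ('a \<rightharpoonup> 'a)" where
  "phi s = (\<lambda>x. Some (x * s)) |` D_set s"

definition vagner_preston :: "'a::semigroup_mult \<Rightarrow> ('a \<rightharpoonup> 'a)" where
  "vagner_preston s = (\<lambda>x. Some (x * s)) |` left_mults (s * sinv s)"


section \<open>Congruences\<close>

definition congruence :: "('a::semigroup_mult \<times> 'a) set \<Rightarrow> bool" where
  "congruence \<rho> \<longleftrightarrow> equiv UNIV \<rho> \<and>
     (\<forall>s t u. (s, t) \<in> \<rho> \<longrightarrow> (s * u, t * u) \<in> \<rho> \<and> (u * s, u * t) \<in> \<rho>)"

definition separates_regular :: "('a::semigroup_mult \<times> 'a) set \<Rightarrow> bool" where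
  "separates_regular \<rho> \<longleftrightarrow> (\<forall>s \<in> Reg. \<forall>t \<in> Reg. (s, t) \<in> \<rho> \<longrightarrow> s = t)"

definition ker_rel :: "('a \<Rightarrow> 'b) \<Rightarrow> ('a \<times> 'a) set" where
  "ker_rel f = {(s, t). f s = f t}"

end

theory Submission
  imports Defs
begin

text \<open>
  Everything rests on describing the sets \<open>D_set s\<close> and \<open>I_set s\<close> by an equation instead of by
  idempotents.  If \<open>x * s * u = x\<close> for some \<open>u\<close>, the elements of \<open>sS\<close> that fix \<open>x\<close> on the right form a
  nonempty subsemigroup, and finiteness gives an idempotent in it.  Hence \<open>D_set s\<close> consists of
  all \<open>x\<close> from which multiplication by \<open>s\<close> can be undone, and \<open>I_set s\<close> of all \<open>z\<close> that are the result
  of such an undoable step: \<open>z * u * s = z\<close> for some \<open>u\<close> (lemmas \<open>D_set_iff\<close>, \<open>I_set_iff\<close>).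
  In this form the domain of \<open>phi (s * t)\<close> is visibly that of \<open>phi s \<Zsemi> phi t\<close>, and \<open>x \<mapsto> x * s\<close> visibly
  maps \<open>D_set s\<close> onto \<open>I_set s\<close>.

  The block-group hypothesis enters through lemma \<open>undo_unique\<close>: the result of undoing the
  multiplication by \<open>s\<close> does not depend on the way it is done, that is, \<open>z * u * s = z\<close> and
  \<open>z * w * s = z\<close> imply \<open>z * u = z * w\<close>.  The reason is that two idempotents \<open>e\<close> and \<open>f\<close> fixing \<open>z\<close>
  have a common lower bound: an idempotent \<open>g\<close> with \<open>g * e = g = g * f\<close> that still fixes \<open>z\<close>.
  Once \<open>u\<close> and \<open>w\<close> are adjusted so that \<open>u * s\<close> and \<open>w * s\<close> are such idempotents, \<open>g * u\<close> and \<open>g * w\<close>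
  are inverses of the single element \<open>s * g\<close>, hence equal.  This yields injectivity of \<open>phi s\<close>, and,
  with the inverse of a regular \<open>s\<close> as one of the two ways of undoing, also the description of
  \<open>D_set s\<close>.  From the latter, a regular \<open>s\<close> is recovered as the value of \<open>phi s\<close> at the unique
  idempotent generator of its domain.

  For maximality, let \<open>\<rho>\<close> be a congruence separating regular elements, \<open>(s, t) \<in> \<rho>\<close>, and \<open>e\<close> an
  idempotent in \<open>sS\<close>.  Replacing \<open>s\<close> by \<open>t\<close> gives an element of \<open>tS\<close> in the \<open>\<rho>\<close>-class of \<open>e\<close>, hence
  also an idempotent there, and this idempotent has to be \<open>e\<close>.  So \<open>e\<close> lies in \<open>tS\<close>
  as well; then \<open>e * s\<close> and \<open>e * t\<close> are regular, congruent and therefore equal, which makes \<open>phi s\<close>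
  and \<open>phi t\<close> agree.
\<close>

section \<open>Idempotents in finite semigroups\<close>

text \<open>
  Induction on the subsemigroup: either \<open>T * a\<close> or the stabilizer of \<open>a\<close> in \<open>T\<close> is a smaller
  subsemigroup, or both are all of \<open>T\<close> and \<open>a\<close> itself is idempotent.
\<close>
lemma subsemigroup_has_idempotent:
  fixes T :: "'a::{semigroup_mult, finite} set"
  assumes "T \<noteq> {}" and "\<And>a b. a \<in> T \<Longrightarrow> b \<in> T \<Longrightarrow> a * b \<in> T"
  shows "\<exists>e \<in> T. e * e = e"
  using finite[of T] assms
proof (induction T rule: finite_psubset_induct)
  case (psubset T)
  obtain a where a: "a \<in> T"
    using psubset.prems(1) by blast
  let ?Ta = "(\<lambda>x. x * a) ` T" and ?St = "{x \<in> T. x * a = a}"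
  have Ta: "?Ta \<subseteq> T" "?Ta \<noteq> {}" "\<And>x y. x \<in> ?Ta \<Longrightarrow> y \<in> ?Ta \<Longrightarrow> x * y \<in> ?Ta"
    using a psubset.prems(2) by (auto simp flip: mult.assoc)
  have St: "\<And>x y. x \<in> ?St \<Longrightarrow> y \<in> ?St \<Longrightarrow> x * y \<in> ?St"
    using psubset.prems(2) by (auto simp: mult.assoc)
  consider "?Ta \<subset> T" | "?Ta = T" "?St \<subset> T" | "?St = T"
    using Ta(1) by blast
  then show ?case
  proof cases
    case 1
    from psubset.IH[OF 1 Ta(2,3)] Ta(1) show ?thesis by blast
  next
    case 2
    have "?St \<noteq> {}"
      using a 2(1) by (force simp: image_iff)
    from psubset.IH[OF 2(2) this St] show ?thesis by blast
  next
    case 3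
    then show ?thesis using a by blast
  qed
qed


section \<open>Domains and ranges described by equations\<close>

lemma R_idem_iff:
  fixes e s :: "'a::semigroup_mult"
  shows "e \<in> R_idem s \<longleftrightarrow> e * e = e \<and> (\<exists>u. e = s * u)"
proof
  assume "e \<in> R_idem s"
  then have idem: "e * e = e"
    and sub: "(\<lambda>u. mult_S1 (Some e) u) ` S1 \<subseteq> (\<lambda>u. mult_S1 (Some s) u) ` S1"
    by (auto simp: R_idem_def Idem_def le_R_def)
  have "Some e \<in> (\<lambda>u. mult_S1 (Some e) u) ` S1"
  proof (cases "\<exists>i::'a. \<forall>x. i * x = x \<and> x * i = x")
    case True
    then obtain i :: 'a where "e * i = e" "i * e = e" by blast
    with True show ?thesis
      by (simp only: S1_def if_True) (rule image_eqI[of _ _ "Some i"]; simp)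
  next
    case False
    then show ?thesis by (simp only: S1_def if_False) (rule image_eqI[of _ _ None]; simp)
  qed
  with sub obtain v where v: "Some e = mult_S1 (Some s) v"
    by blast
  \<comment> \<open>For \<open>v = None\<close> we have \<open>e = s\<close>, and idempotency gives \<open>e = s * e\<close>.\<close>
  from v idem show "e * e = e \<and> (\<exists>u. e = s * u)"
    by (cases v) (auto intro: exI[of _ e])
next
  assume "e * e = e \<and> (\<exists>u. e = s * u)"
  then obtain u where idem: "e * e = e" and u: "e = s * u" by blast
  have "\<exists>w \<in> S1. mult_S1 (Some e) v = mult_S1 (Some s) w" if "v \<in> S1" for v
  proof (cases v)
    case None
    with u that show ?thesis
      by (intro bexI[of _ "Some u"]) (auto simp: S1_def)
  next
    case (Some y)
    with u show ?thesis
      by (intro bexI[of _ "Some (u * y)"]) (auto simp: S1_def mult.assoc)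
  qed
  with idem show "e \<in> R_idem s"
    by (auto simp: R_idem_def Idem_def le_R_def)
qed

lemma L_idem_iff:
  fixes e s :: "'a::semigroup_mult"
  shows "e \<in> L_idem s \<longleftrightarrow> e * e = e \<and> (\<exists>u. e = u * s)"
proof
  assume "e \<in> L_idem s"
  then have idem: "e * e = e"
    and sub: "(\<lambda>u. mult_S1 u (Some e)) ` S1 \<subseteq> (\<lambda>u. mult_S1 u (Some s)) ` S1"
    by (auto simp: L_idem_def Idem_def le_L_def)
  have "Some e \<in> (\<lambda>u. mult_S1 u (Some e)) ` S1"
  proof (cases "\<exists>i::'a. \<forall>x. i * x = x \<and> x * i = x")
    case True
    then obtain i :: 'a where "e * i = e" "i * e = e" by blast
    with True show ?thesis
      by (simp only: S1_def if_True) (rule image_eqI[of _ _ "Some i"]; simp)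
  next
    case False
    then show ?thesis by (simp only: S1_def if_False) (rule image_eqI[of _ _ None]; simp)
  qed
  with sub obtain v where v: "Some e = mult_S1 v (Some s)"
    by blast
  from v idem show "e * e = e \<and> (\<exists>u. e = u * s)"
    by (cases v) (auto intro: exI[of _ e])
next
  assume "e * e = e \<and> (\<exists>u. e = u * s)"
  then obtain u where idem: "e * e = e" and u: "e = u * s" by blast
  have "\<exists>w \<in> S1. mult_S1 v (Some e) = mult_S1 w (Some s)" if "v \<in> S1" for v
  proof (cases v)
    case None
    with u that show ?thesis
      by (intro bexI[of _ "Some u"]) (auto simp: S1_def)
  next
    case (Some y)
    with u show ?thesis
      by (intro bexI[of _ "Some (y * u)"]) (auto simp: S1_def mult.assoc)
  qed
  with idem show "e \<in> L_idem s"
    by (auto simp: L_idem_def Idem_def le_L_def)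
qed

lemma left_mults_idem_iff:
  assumes "e * e = e"
  shows "x \<in> left_mults e \<longleftrightarrow> x * e = x"
proof
  assume "x * e = x"
  then show "x \<in> left_mults e"
    unfolding left_mults_def by (simp, intro exI[of _ x], simp)
qed (use assms in \<open>auto simp: left_mults_def mult.assoc\<close>)

lemma D_set_obtains_idem:
  assumes "x \<in> D_set s"
  obtains e w where "e * e = e" "e = s * w" "x * e = x"
  using assms unfolding D_set_def
  by (auto simp: R_idem_iff left_mults_idem_iff)

text \<open>
  The elements of \<open>sS\<close> that fix \<open>x\<close> are closed under multiplication; an idempotent among them
  witnesses membership in \<open>D_set s\<close>.
\<close>
lemma D_set_iff:
  fixes x s :: "'a::{semigroup_mult, finite}"
  shows "x \<in> D_set s \<longleftrightarrow> (\<exists>u. x * s * u = x)"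
proof
  assume "x \<in> D_set s"
  then obtain e w where "e = s * w" "x * e = x"
    by (rule D_set_obtains_idem)
  then show "\<exists>u. x * s * u = x"
    by (auto simp: mult.assoc)
next
  assume "\<exists>u. x * s * u = x"
  then obtain u where u: "x * s * u = x" ..
  let ?T = "{a. x * a = x \<and> (\<exists>v. a = s * v)}"
  have "s * u \<in> ?T" using u by (auto simp: mult.assoc)
  then have "?T \<noteq> {}" by blast
  moreover have "a * b \<in> ?T" if "a \<in> ?T" "b \<in> ?T" for a b
    using that by (auto simp: mult.assoc) (metis mult.assoc)
  ultimately obtain e where "e \<in> ?T" "e * e = e"
    using subsemigroup_has_idempotent[of ?T] by blast
  then have "e \<in> R_idem s" "x \<in> left_mults e"
    by (auto simp: R_idem_iff left_mults_idem_iff)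
  then show "x \<in> D_set s"
    unfolding D_set_def by blast
qed

lemma I_set_iff:
  fixes z s :: "'a::{semigroup_mult, finite}"
  shows "z \<in> I_set s \<longleftrightarrow> (\<exists>u. z * u * s = z)"
proof
  assume "z \<in> I_set s"
  then show "\<exists>u. z * u * s = z"
    unfolding I_set_def by (auto simp: L_idem_iff left_mults_idem_iff mult.assoc)
next
  assume "\<exists>u. z * u * s = z"
  then obtain u where u: "z * u * s = z" ..
  let ?T = "{a. z * a = z \<and> (\<exists>v. a = v * s)}"
  have "u * s \<in> ?T" using u by (auto simp: mult.assoc)
  then have "?T \<noteq> {}" by blast
  moreover have "a * b \<in> ?T" if "a \<in> ?T" "b \<in> ?T" for a b
    using that by (auto simp flip: mult.assoc)
  ultimately obtain e where "e \<in> ?T" "e * e = e"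
    using subsemigroup_has_idempotent[of ?T] by blast
  then have "e \<in> L_idem s" "z \<in> left_mults e"
    by (auto simp: L_idem_iff left_mults_idem_iff)
  then show "z \<in> I_set s"
    unfolding I_set_def by blast
qed

lemma mult_image_D_set:
  fixes s :: "'a::{semigroup_mult, finite}"
  shows "(\<lambda>x. x * s) ` D_set s = I_set s"
proof (intro equalityI subsetI)
  fix z assume "z \<in> (\<lambda>x. x * s) ` D_set s"
  then obtain x u where "z = x * s" "x * s * u = x"
    by (auto simp: D_set_iff)
  then show "z \<in> I_set s"
    by (auto simp: I_set_iff intro: exI[of _ u])
next
  fix z assume "z \<in> I_set s"
  then obtain u where "z * u * s = z"
    by (auto simp: I_set_iff)
  then show "z \<in> (\<lambda>x. x * s) ` D_set s"
    by (intro image_eqI[of _ _ "z * u"]) (auto simp: D_set_iff)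
qed

lemma D_set_mult_iff:
  fixes x s t :: "'a::{semigroup_mult, finite}"
  shows "x \<in> D_set (s * t) \<longleftrightarrow> x \<in> D_set s \<and> x * s \<in> D_set t"
  unfolding D_set_iff by (metis mult.assoc)

lemma phi_mult:
  fixes s t :: "'a::{semigroup_mult, finite}"
  shows "phi (s * t) = phi s \<Zsemi> phi t"
  by (rule ext)
     (auto simp: phi_def pcomp_def map_comp_def restrict_map_def D_set_mult_iff mult.assoc)

lemma dom_phi: "dom (phi s) = D_set s"
  by (auto simp: phi_def restrict_map_def split: if_splits)

lemma phi_eq_iff:
  "phi s = phi t \<longleftrightarrow> D_set s = D_set t \<and> (\<forall>x \<in> D_set s. x * s = x * t)"
proof
  assume eq: "phi s = phi t"
  then have "D_set s = D_set t" by (metis dom_phi)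
  moreover have "x * s = x * t" if "x \<in> D_set s" for x
    using that fun_cong[OF eq, of x] \<open>D_set s = D_set t\<close> by (simp add: phi_def)
  ultimately show "D_set s = D_set t \<and> (\<forall>x \<in> D_set s. x * s = x * t)" by blast
qed (auto simp: phi_def restrict_map_def fun_eq_iff)


section \<open>Uniqueness of undoing in block-groups\<close>

lemma block_group_inverse_unique:
  fixes s :: "'a::{semigroup_mult, finite}"
  assumes "block_group TYPE('a)" "is_inverse s t" "is_inverse s u"
  shows "t = u"
  using assms by (auto simp: block_group_def)

text \<open>
  Two idempotents generating the same right ideal are both inverses of either of them.
\<close>
lemma idem_R_equal:
  fixes e f :: "'a::{semigroup_mult, finite}"
  assumes "block_group TYPE('a)" "e * e = e" "f * f = f" "e * f = f" "f * e = e"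
  shows "e = f"
  by (rule block_group_inverse_unique[of e, OF assms(1)]) (simp_all add: is_inverse_def assms)

lemma idem_L_equal:
  fixes e f :: "'a::{semigroup_mult, finite}"
  assumes "block_group TYPE('a)" "e * e = e" "f * f = f" "e * f = e" "f * e = f"
  shows "e = f"
  by (rule block_group_inverse_unique[of e, OF assms(1)]) (simp_all add: is_inverse_def assms)

text \<open>
  Some power of \<open>e * f\<close> is idempotent and could serve as \<open>g\<close>; all that matters about it is that
  \<open>e * g = g\<close>, \<open>g * f = g\<close> and \<open>z * g = z\<close>.  The first equation makes \<open>g * e\<close> an idempotent that
  generates the same right ideal as \<open>g\<close>, so the two coincide.
\<close>
lemma common_lower_idempotent:
  fixes e f z :: "'a::{semigroup_mult, finite}"
  assumes bg: "block_group TYPE('a)"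
    and e: "e * e = e" "z * e = z" and f: "f * f = f" "z * f = z"
  obtains g where "g * g = g" "z * g = z" "g * e = g" "g * f = g"
proof -
  let ?T = "{a. e * a = a \<and> a * f = a \<and> z * a = z}"
  have "e * f \<in> ?T"
    using e f by (simp add: mult.assoc) (simp add: e f flip: mult.assoc)
  then have "?T \<noteq> {}" by blast
  moreover have "a * b \<in> ?T" if "a \<in> ?T" "b \<in> ?T" for a b
    using that by (auto simp: mult.assoc) (simp_all flip: mult.assoc)
  ultimately obtain g where g: "e * g = g" "g * f = g" "z * g = z" "g * g = g"
    using subsemigroup_has_idempotent[of ?T] by blast
  have "g * e = g"
    by (rule idem_R_equal[OF bg]) (metis g mult.assoc)+
  with g that show thesis by blast
qed

text \<open>
  An undoing factor \<open>u\<close> can be replaced by one whose product with \<open>s\<close> is idempotent.  For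
  \<open>p = b * u\<close> with \<open>z * b = z\<close> the effect on \<open>z\<close> is that of \<open>u\<close>, and the products \<open>b * u * s\<close> with
  such \<open>b\<close> form a subsemigroup.
\<close>
lemma idempotent_undo:
  fixes z u s :: "'a::{semigroup_mult, finite}"
  assumes zus: "z * u * s = z"
  obtains p where "(p * s) * (p * s) = p * s" "z * p = z * u"
proof -
  let ?T = "{a. \<exists>b. a = b * u * s \<and> z * b = z}"
  \<comment> \<open>The square is used because \<open>u * s\<close> itself need not have the form \<open>b * u * s\<close>.\<close>
  have "(u * s) * u * s \<in> ?T"
    using zus by (auto simp flip: mult.assoc intro!: exI[of _ "u * s"])
  then have "?T \<noteq> {}" by blast
  moreover have "a * a' \<in> ?T" if "a \<in> ?T" "a' \<in> ?T" for a a'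
  proof -
    obtain b b' where b: "a = b * u * s" "z * b = z" "a' = b' * u * s" "z * b' = z"
      using \<open>a \<in> ?T\<close> \<open>a' \<in> ?T\<close> by blast
    have "a * a' = (b * u * s * b') * u * s" "z * (b * u * s * b') = z"
      using b zus by (simp_all flip: mult.assoc)
    then show ?thesis by blast
  qed
  ultimately obtain a where "a \<in> ?T" "a * a = a"
    using subsemigroup_has_idempotent[of ?T] by blast
  then obtain b where "a = b * u * s" "z * b = z" "a * a = a" by blast
  then show thesis
    by (intro that[of "b * u"]) (simp_all flip: mult.assoc)
qed

text \<open>
  By the two preceding lemmas \<open>u\<close> and \<open>w\<close> may be replaced by \<open>g * p\<close> and \<open>g * q\<close>, for
  an idempotent \<open>g\<close> fixing \<open>z\<close> with \<open>g * p * s = g = g * q * s\<close>.  Both are then inverses of \<open>s * g\<close>.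
\<close>
lemma undo_unique:
  fixes z u w s :: "'a::{semigroup_mult, finite}"
  assumes bg: "block_group TYPE('a)" and u: "z * u * s = z" and w: "z * w * s = z"
  shows "z * u = z * w"
proof -
  obtain p where p: "(p * s) * (p * s) = p * s" "z * p = z * u"
    using idempotent_undo[OF u] .
  obtain q where q: "(q * s) * (q * s) = q * s" "z * q = z * w"
    using idempotent_undo[OF w] .
  have "z * (p * s) = z" "z * (q * s) = z"
    using p(2) q(2) u w by (simp_all flip: mult.assoc)
  then obtain g where g: "g * g = g" "z * g = z" "g * (p * s) = g" "g * (q * s) = g"
    using common_lower_idempotent[OF bg p(1) _ q(1)] by metis
  have inv: "is_inverse (s * g) (g * r)" if "g * (r * s) = g" for r
    unfolding is_inverse_def by (metis g(1) that mult.assoc)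
  have "g * p = g * q"
    by (rule block_group_inverse_unique[OF bg inv[OF g(3)] inv[OF g(4)]])
  then have "z * p = z * q"
    by (metis g(2) mult.assoc)
  with p q show ?thesis by simp
qed

lemma inj_on_mult_D_set:
  fixes s :: "'a::{semigroup_mult, finite}"
  assumes "block_group TYPE('a)"
  shows "inj_on (\<lambda>x. x * s) (D_set s)"
proof (rule inj_onI)
  fix x y assume "x \<in> D_set s" "y \<in> D_set s" and eq: "x * s = y * s"
  then obtain u w where "x * s * u = x" "y * s * w = y"
    by (auto simp: D_set_iff)
  with undo_unique[OF assms, of "x * s" u s w] eq show "x = y" by simp
qed

lemma phi_in_sym_inv:
  fixes s :: "'a::{semigroup_mult, finite}"
  assumes "block_group TYPE('a)"
  shows "phi s \<in> sym_inv UNIV"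
proof -
  have "inj_on (phi s) (D_set s)"
    using inj_on_mult_D_set[OF assms, of s] by (auto simp: inj_on_def phi_def)
  then show ?thesis by (simp add: sym_inv_def dom_phi)
qed


section \<open>Regular elements\<close>

lemma is_inverse_sinv:
  fixes s :: "'a::{semigroup_mult, finite}"
  assumes bg: "block_group TYPE('a)" and "s \<in> Reg"
  shows "is_inverse s (sinv s)"
proof -
  obtain x where "s = s * x * s"
    using \<open>s \<in> Reg\<close> unfolding Reg_def by blast
  then have "is_inverse s (x * s * x)"
    unfolding is_inverse_def by (metis mult.assoc)
  then have "\<exists>!t. is_inverse s t"
    using block_group_inverse_unique[OF bg] by blast
  then show ?thesis
    unfolding sinv_def by (rule theI')
qed

lemma is_inverse_idempotents:
  assumes "is_inverse s t"
  shows "(s * t) * (s * t) = s * t" "(t * s) * (t * s) = t * s"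
  using assms by (simp_all add: is_inverse_def flip: mult.assoc)

text \<open>
  Multiplication by \<open>s\<close> can be undone on \<open>D_set s\<close> by the inverse of \<open>s\<close>, since all ways of undoing
  it agree.
\<close>
lemma D_set_inverse:
  fixes s t :: "'a::{semigroup_mult, finite}"
  assumes bg: "block_group TYPE('a)" and st: "is_inverse s t"
  shows "D_set s = left_mults (s * t)"
proof -
  have "x * s * t = x" if "x * s * u = x" for x u
  proof -
    have "x * s * t * s = x * s"
      using st by (simp add: is_inverse_def mult.assoc)
    moreover have "x * s * u * s = x * s"
      using that by simp
    ultimately show ?thesis
      using undo_unique[OF bg, of "x * s" t s u] that by simp
  qed
  then show ?thesis
    using is_inverse_idempotents(1)[OF st]
    by (auto simp: D_set_iff left_mults_idem_iff simp flip: mult.assoc)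
qed

lemma I_set_inverse:
  fixes s t :: "'a::{semigroup_mult, finite}"
  assumes st: "is_inverse s t"
  shows "I_set s = left_mults (t * s)"
proof -
  have "z * t * s = z" if "z * u * s = z" for z u
    using that st unfolding is_inverse_def by (metis mult.assoc)
  then show ?thesis
    using is_inverse_idempotents(2)[OF st]
    by (auto simp: I_set_iff left_mults_idem_iff simp flip: mult.assoc)
qed

text \<open>
  The common domain of \<open>phi s\<close> and \<open>phi t\<close> is a principal left ideal generated by an idempotent \<open>p\<close>,
  which is unique in a block-group.  Evaluating both maps at \<open>p\<close> returns \<open>s\<close> and \<open>t\<close>.
\<close>
lemma inj_on_phi_Reg:
  assumes bg: "block_group TYPE('a::{semigroup_mult, finite})"
  shows "inj_on phi (Reg :: 'a set)"
proof (rule inj_onI)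
  fix s t :: 'a
  assume "s \<in> Reg" "t \<in> Reg" and eq: "phi s = phi t"
  let ?p = "s * sinv s" and ?q = "t * sinv t"
  have inv: "is_inverse s (sinv s)" "is_inverse t (sinv t)"
    using is_inverse_sinv[OF bg] \<open>s \<in> Reg\<close> \<open>t \<in> Reg\<close> by auto
  note idem = is_inverse_idempotents(1)[OF inv(1)] is_inverse_idempotents(1)[OF inv(2)]
  have D: "left_mults ?p = left_mults ?q"
    using eq D_set_inverse[OF bg inv(1)] D_set_inverse[OF bg inv(2)] by (simp add: phi_eq_iff)
  have p: "?p \<in> left_mults ?p" and q: "?q \<in> left_mults ?q"
    by (simp_all only: left_mults_idem_iff[OF idem(1)] left_mults_idem_iff[OF idem(2)] idem)
  have "?p * ?q = ?p" "?q * ?p = ?q"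
    using p q D left_mults_idem_iff[OF idem(1)] left_mults_idem_iff[OF idem(2)] by blast+
  then have "?p = ?q"
    using idem_L_equal[OF bg idem] by blast
  moreover have "?p * s = ?p * t"
    using eq p D_set_inverse[OF bg inv(1)] by (simp add: phi_eq_iff)
  ultimately show "s = t"
    using inv by (simp add: is_inverse_def)
qed


section \<open>The kernel as largest separating congruence\<close>

lemma congruence_ker_phi:
  "congruence (ker_rel (phi :: 'a::{semigroup_mult, finite} \<Rightarrow> 'a \<rightharpoonup> 'a))"
proof -
  have "equiv UNIV (ker_rel (phi :: 'a \<Rightarrow> 'a \<rightharpoonup> 'a))"
    by (intro equivI) (auto simp: ker_rel_def refl_on_def sym_def trans_def)
  then show ?thesis
    by (simp add: congruence_def ker_rel_def phi_mult)
qed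

text \<open>
  Write an idempotent \<open>e\<close> as \<open>e = s * w\<close>.  Then \<open>t * w\<close> is congruent to \<open>e\<close>, so the part of
  \<open>tS\<close> inside the class of \<open>e\<close> is a nonempty subsemigroup, and the only regular element that it can
  contain is \<open>e\<close>.
\<close>
lemma separating_congruence_idem:
  fixes s t e w :: "'a::{semigroup_mult, finite}"
  assumes cong: "congruence \<rho>" and sep: "separates_regular \<rho>" and st: "(s, t) \<in> \<rho>"
    and e: "e * e = e" "e = s * w"
  obtains v where "e = t * v" "e * s = e * t"
proof -
  have \<rho>: "sym \<rho>" "trans \<rho>" "\<And>a. (a, a) \<in> \<rho>"
      "\<And>a b c. (a, b) \<in> \<rho> \<Longrightarrow> (a * c, b * c) \<in> \<rho>" "\<And>a b c. (a, b) \<in> \<rho> \<Longrightarrow> (c * a, c * b) \<in> \<rho>"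
    using cong by (auto simp: congruence_def equiv_def refl_on_def)
  let ?T = "{a. (a, e) \<in> \<rho> \<and> (\<exists>v. a = t * v)}"
  have "t * w \<in> ?T"
    using \<rho>(4)[OF st, of w] e(2) \<rho>(1) by (auto dest: symD)
  then have "?T \<noteq> {}" by blast
  moreover have "a * b \<in> ?T" if "a \<in> ?T" "b \<in> ?T" for a b
  proof -
    have "(a * b, e * b) \<in> \<rho>" "(e * b, e * e) \<in> \<rho>"
      using that \<rho>(4,5) by auto
    then have "(a * b, e) \<in> \<rho>"
      using e(1) \<rho>(2) by (metis transD)
    then show ?thesis
      using that by (auto simp: mult.assoc)
  qed
  ultimately obtain a where a: "a \<in> ?T" "a * a = a"
    using subsemigroup_has_idempotent[of ?T] by blast
  have "a \<in> Reg" "e \<in> Reg"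
    using a(2) e(1) by (auto simp: Reg_def intro: exI[of _ a] exI[of _ e])
  then have "a = e"
    using sep a(1) by (auto simp: separates_regular_def)
  with a(1) obtain v where v: "e = t * v" by blast
  have "e * s = e * s * w * (e * s)" "e * t = e * t * v * (e * t)"
    by (metis e v mult.assoc)+
  then have "e * s \<in> Reg" "e * t \<in> Reg"
    unfolding Reg_def by blast+
  then have "e * s = e * t"
    using sep \<rho>(5)[OF st, of e] by (auto simp: separates_regular_def)
  with v show thesis by (rule that)
qed

lemma separating_congruence_D_set:
  fixes s t x :: "'a::{semigroup_mult, finite}"
  assumes "congruence \<rho>" "separates_regular \<rho>" "(s, t) \<in> \<rho>" and x: "x \<in> D_set s"
  shows "x \<in> D_set t" "x * s = x * t"
proof -
  obtain e w where e: "e * e = e" "e = s * w" "x * e = x"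
    using D_set_obtains_idem[OF x] .
  obtain v where v: "e = t * v" "e * s = e * t"
    using separating_congruence_idem[OF assms(1-3) e(1,2)] .
  show "x \<in> D_set t"
    unfolding D_set_iff by (metis e(3) v(1) mult.assoc)
  show "x * s = x * t"
    by (metis e(3) v(2) mult.assoc)
qed

lemma separating_congruence_subset_ker_phi:
  fixes \<rho> :: "('a::{semigroup_mult, finite} \<times> 'a) set"
  assumes "congruence \<rho>" "separates_regular \<rho>"
  shows "\<rho> \<subseteq> ker_rel phi"
proof (rule subrelI)
  fix s t assume st: "(s, t) \<in> \<rho>"
  then have ts: "(t, s) \<in> \<rho>"
    using assms(1) by (auto simp: congruence_def equiv_def dest: symD)
  show "(s, t) \<in> ker_rel phi"
    using separating_congruence_D_set[OF assms st] separating_congruence_D_set(1)[OF assms ts]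
    by (auto simp: ker_rel_def phi_eq_iff)
qed


section \<open>The representation theorem\<close>

theorem theorem6:
  assumes "block_group TYPE('a::{semigroup_mult, finite})"
  shows
    "(\<forall>s::'a. bij_betw (\<lambda>x. x * s) (D_set s) (I_set s) \<and> phi s \<in> sym_inv UNIV) \<and>
     (\<forall>s t::'a. phi (s * t) = phi s \<Zsemi> phi t) \<and>
     inj_on phi (Reg :: 'a set) \<and>
     separates_regular (ker_rel (phi :: 'a \<Rightarrow> 'a \<rightharpoonup> 'a)) \<and>
     (\<forall>s::'a. s \<in> Reg \<longrightarrow>
        D_set s = left_mults (s * sinv s) \<and> I_set s = left_mults (sinv s * s)) \<and>
     (inverse_semigroup TYPE('a) \<longrightarrow> (\<forall>s::'a. phi s = vagner_preston s)) \<and>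
     congruence (ker_rel (phi :: 'a \<Rightarrow> 'a \<rightharpoonup> 'a)) \<and>
     (\<forall>\<rho> :: ('a \<times> 'a) set. congruence \<rho> \<and> separates_regular \<rho> \<longrightarrow>
        \<rho> \<subseteq> ker_rel (phi :: 'a \<Rightarrow> 'a \<rightharpoonup> 'a))"
proof (intro conjI allI impI)
  fix s t :: 'a
  show "bij_betw (\<lambda>x. x * s) (D_set s) (I_set s)"
    by (simp add: bij_betw_def inj_on_mult_D_set[OF assms] mult_image_D_set)
  show "phi s \<in> sym_inv UNIV"
    by (rule phi_in_sym_inv[OF assms])
  show "phi (s * t) = phi s \<Zsemi> phi t"
    by (rule phi_mult)
next
  show "inj_on phi (Reg :: 'a set)"
    by (rule inj_on_phi_Reg[OF assms])
  then show "separates_regular (ker_rel (phi :: 'a \<Rightarrow> 'a \<rightharpoonup> 'a))"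
    by (auto simp: separates_regular_def ker_rel_def inj_on_def)
next
  fix s :: 'a
  assume "s \<in> Reg"
  then have "is_inverse s (sinv s)"
    by (rule is_inverse_sinv[OF assms])
  then show "D_set s = left_mults (s * sinv s)" "I_set s = left_mults (sinv s * s)"
    by (rule D_set_inverse[OF assms], rule I_set_inverse)
next
  fix s :: 'a
  assume "inverse_semigroup TYPE('a)"
  then have "is_inverse s (sinv s)"
    unfolding inverse_semigroup_def sinv_def by (blast intro: theI')
  then show "phi s = vagner_preston s"
    by (simp add: phi_def vagner_preston_def D_set_inverse[OF assms])
next
  show "congruence (ker_rel (phi :: 'a \<Rightarrow> 'a \<rightharpoonup> 'a))"
    by (rule congruence_ker_phi)
next
  fix \<rho> :: "('a \<times> 'a) set"
  assume "congruence \<rho> \<and> separates_regular \<rho>"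
  then show "\<rho> \<subseteq> ker_rel (phi :: 'a \<Rightarrow> 'a \<rightharpoonup> 'a)"
    by (blast intro: separating_congruence_subset_ker_phi[THEN subsetD])
qed

end
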